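(* Let $n=pq$, where $p$ and $q$ are distinct primes. Then $\alpha\bigl(\Theta(\mathbb{Z}_n)\bigr)=(p-1)(q-1)$.
   Context: $\mathbb{Z}_n$ denotes the cyclic group of order $n$. For a finite group $G$, $|g|$ denotes the order of $g\in G$, and the prime-coprime graph $\Theta(G)$ is the simple graph with vertex set $G$ in which two distinct vertices $g,h$ are adjacent if and only if $\gcd(|g|,|h|)$ is either $1$ or a prime. The independence number $\alpha(\Gamma)$ of a graph $\Gamma$ is the maximum cardinality of an independent set of $\Gamma$. *)

theory Defs
  imports
    "HOL-Algebra.Elementary_Groups"
    "HOL-Algebra.Multiplicative_Group"
    "HOL-Computational_Algebra.Primes"
    "Graph_Theory.Graph_Theory"
begin

text \<open>
  Simple graphs are the locale \<^locale>\<open>pair_graph\<close>: every edge is represented by its two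
  opposite arcs.
\<close>

definition prime_coprime_graph :: "('a, 'b) monoid_scheme \<Rightarrow> 'a pair_pre_digraph" where
  "prime_coprime_graph G =
     \<lparr> pverts = carrier G,
       parcs = {(g, h). g \<in> carrier G \<and> h \<in> carrier G \<and> g \<noteq> h \<and>
                  (gcd (group.ord G g) (group.ord G h) = 1 \<or>
                   prime (gcd (group.ord G g) (group.ord G h)))} \<rparr>"

lemma pair_graph_prime_coprime_graph:
  assumes "finite (carrier G)"
  shows "pair_graph (prime_coprime_graph G)"
proof
  show "finite (parcs (prime_coprime_graph G))"
    by (rule finite_subset[OF _ finite_cartesian_product[OF assms assms]])
       (auto simp: prime_coprime_graph_def)
qed (use assms in \<open>auto simp: prime_coprime_graph_def symmetric_def gcd.commute intro!: symI\<close>)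

definition independent_set :: "('a, 'b) pre_digraph \<Rightarrow> 'a set \<Rightarrow> bool" where
  "independent_set G S \<longleftrightarrow> S \<subseteq> verts G \<and> (\<forall>u\<in>S. \<forall>v\<in>S. \<not> u \<rightarrow>\<^bsub>G\<^esub> v)"

text \<open>
  The maximum is only meaningful for graphs with finitely many vertices.
\<close>

definition independence_number :: "('a, 'b) pre_digraph \<Rightarrow> nat" where
  "independence_number G = Max {card S | S. independent_set G S}"

end

(* For n = p q, a divisor of n is 1, a prime or n, so distinct g and h are non-adjacent
   only if gcd(|g|, |h|) = n, that is, only if both generate the group.  Hence an independent
   set with at least two elements consists of generators, the generators form an independent
   set, and there are totient n = (p - 1)(q - 1) of them. *)
theory Submission
  imports Defs "HOL-Number_Theory.Totient"
begin

lemma finite_carrier_integer_mod_group: "n > 0 \<Longrightarrow> finite (carrier (integer_mod_group n))"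
  by (simp add: carrier_integer_mod_group)

lemma ord_integer_mod_group_dvd:
  assumes "x \<in> carrier (integer_mod_group n)"
  shows "group.ord (integer_mod_group n) x dvd n"
  using group.pow_eq_id[OF group_integer_mod_group assms, of n] by simp

lemma ord_integer_mod_group_1:
  assumes "n > 1"
  shows "group.ord (integer_mod_group n) 1 = n"
proof -
  \<comment> \<open>The group is additive: the \<open>m\<close>-th power of 1 is
    \<open>m mod n\<close>, and the identity is 0. This condition for all \<open>m\<close>
    determines the order.\<close>
  have "(1 [^]\<^bsub>integer_mod_group n\<^esub> m = \<one>\<^bsub>integer_mod_group n\<^esub>) \<longleftrightarrow> n dvd m" for m :: nat
    by (simp flip: dvd_eq_mod_eq_0)
  then show ?thesis
    using assms by (subst group.ord_unique) auto
qed

text \<open>Since \<open>x\<close> is the \<open>nat x\<close>-th power of the generator 1, this is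
  the fact that a \<open>k\<close>-th power keeps the order of its base exactly when
  \<open>k\<close> is coprime to that order.\<close>

lemma ord_integer_mod_group_eq_iff:
  assumes "n > 1" and x: "x \<in> carrier (integer_mod_group n)"
  shows "group.ord (integer_mod_group n) x = n \<longleftrightarrow> coprime (nat x) n"
proof -
  have "1 [^]\<^bsub>integer_mod_group n\<^esub> nat x = x"
    using assms by (simp add: carrier_integer_mod_group)
  moreover have "1 \<in> carrier (integer_mod_group n)"
    using assms by simp
  ultimately show ?thesis
    using group.pow_ord_eq_ord_iff[OF group_integer_mod_group, of n 1 "nat x"]
      finite_carrier_integer_mod_group[of n] assms(1)
    by (simp add: ord_integer_mod_group_1)
qed

lemma card_generators_integer_mod_group:
  assumes "n > 1"
  shows "card {x \<in> carrier (integer_mod_group n). group.ord (integer_mod_group n) x = n} = totient n"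
proof -
  have "{x \<in> carrier (integer_mod_group n). group.ord (integer_mod_group n) x = n} = int ` totatives n"
  proof (intro equalityI subsetI)
    fix x assume "x \<in> {x \<in> carrier (integer_mod_group n). group.ord (integer_mod_group n) x = n}"
    then have x: "0 \<le> x" "x < int n" "coprime (nat x) n"
      using assms by (auto simp: ord_integer_mod_group_eq_iff carrier_integer_mod_group)
    \<comment> \<open>Totatives are positive, whereas the carrier contains 0; but gcd(0, n) = n >
      1.\<close>
    moreover have "x \<noteq> 0"
      using x(3) assms by auto
    ultimately have "nat x \<in> totatives n"
      by (simp add: in_totatives_iff)
    then show "x \<in> int ` totatives n"
      using x(1) by (metis image_eqI nat_0_le)
  next
    fix x assume "x \<in> int ` totatives n"
    then obtain k where k: "x = int k" "k \<in> totatives n" by blast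
    \<comment> \<open>At the other end, totatives range up to \<open>n\<close> and the carrier stops
      at n - 1; \<open>n > 1\<close> excludes k = n.\<close>
    moreover have "k < n"
      using k(2) assms by (rule totatives_less)
    ultimately show "x \<in> {x \<in> carrier (integer_mod_group n). group.ord (integer_mod_group n) x = n}"
      using assms by (auto simp: ord_integer_mod_group_eq_iff carrier_integer_mod_group in_totatives_iff)
  qed
  then show ?thesis
    by (simp add: card_image totient_def)
qed

lemma dvd_prime_mult_cases:
  fixes p q d :: nat
  assumes "prime p" "prime q" "d dvd p * q"
  shows "d = 1 \<or> prime d \<or> d = p * q"
\<comment> \<open>Splitting \<open>d\<close> into a divisor of \<open>p\<close> times a divisor of
  \<open>q\<close> leaves four products to check.\<close>
proof -
  obtain b c where d: "d = b * c" "b dvd p" "c dvd q"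
    using division_decomp[OF assms(3)] by blast
  then have "b = 1 \<or> b = p" "c = 1 \<or> c = q"
    using assms(1,2) by (auto simp: prime_nat_iff)
  then show ?thesis
    using d(1) assms(1,2) by auto
qed

lemma adjacent_prime_coprime_graph_iff:
  "g \<rightarrow>\<^bsub>with_proj (prime_coprime_graph G)\<^esub> h \<longleftrightarrow>
     g \<in> carrier G \<and> h \<in> carrier G \<and> g \<noteq> h \<and>
     (gcd (group.ord G g) (group.ord G h) = 1 \<or> prime (gcd (group.ord G g) (group.ord G h)))"
  by (simp add: prime_coprime_graph_def)

lemma adjacent_integer_mod_group_prime_mult_iff:
  fixes p q :: nat
  assumes "prime p" "prime q" and n: "n = p * q"
    and "x \<in> carrier (integer_mod_group n)" "y \<in> carrier (integer_mod_group n)"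
  shows "x \<rightarrow>\<^bsub>with_proj (prime_coprime_graph (integer_mod_group n))\<^esub> y \<longleftrightarrow>
    x \<noteq> y \<and> \<not> (group.ord (integer_mod_group n) x = n \<and> group.ord (integer_mod_group n) y = n)"
proof -
  let ?d = "gcd (group.ord (integer_mod_group n) x) (group.ord (integer_mod_group n) y)"
  note dvd = ord_integer_mod_group_dvd[OF assms(4)] ord_integer_mod_group_dvd[OF assms(5)]
  have "?d dvd n"
    using dvd(1) by (rule dvd_trans[OF gcd_dvd1])
  then have "?d = 1 \<or> prime ?d \<or> ?d = n"
    using dvd_prime_mult_cases[OF assms(1,2)] n by blast
  \<comment> \<open>This makes the case \<open>?d = n\<close> exclusive of the other two, so the
    trichotomy becomes an equivalence.\<close>
  moreover have "n \<noteq> 1" "\<not> prime n"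
    using assms(1,2) n by (auto dest: prime_product)
  ultimately have "\<not> (?d = 1 \<or> prime ?d) \<longleftrightarrow> ?d = n"
    by metis
  also have "\<dots> \<longleftrightarrow> group.ord (integer_mod_group n) x = n \<and> group.ord (integer_mod_group n) y = n"
    using dvd by (metis dvd_antisym gcd_dvd1 gcd_dvd2 gcd_idem_nat)
  finally show ?thesis
    unfolding adjacent_prime_coprime_graph_iff using assms(4,5) by argo
qed

theorem corollary3p12:
  fixes n p q :: nat
  assumes "prime p" and "prime q" and "p \<noteq> q" and "n = p * q"
  shows "independence_number (with_proj (prime_coprime_graph (integer_mod_group n))) = (p - 1) * (q - 1)"
proof -
  let ?Z = "integer_mod_group n"
  let ?\<Theta> = "with_proj (prime_coprime_graph ?Z)"
  let ?gens = "{x \<in> carrier ?Z. group.ord ?Z x = n}"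
  note adjacent_iff = adjacent_integer_mod_group_prime_mult_iff[OF assms(1,2,4)]
  have "n > 1"
    unfolding assms(4) using assms(1,2) by (intro less_1_mult prime_gt_1_nat)
  then have finite: "finite (carrier ?Z)"
    by (simp add: finite_carrier_integer_mod_group)
  have "card ?gens = totient n"
    using \<open>n > 1\<close> by (rule card_generators_integer_mod_group)
  \<comment> \<open>Distinct primes are coprime, so the totient is multiplicative here.\<close>
  then have card_gens: "card ?gens = (p - 1) * (q - 1)"
    using assms by (simp add: totient_mult_coprime totient_prime primes_coprime)
  have verts: "verts ?\<Theta> = carrier ?Z"
    by (simp add: prime_coprime_graph_def)
  have gens: "independent_set ?\<Theta> ?gens"
    unfolding independent_set_def verts using adjacent_iff by auto
  have le: "card S \<le> card ?gens" if S: "independent_set ?\<Theta> S" for S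
  proof (cases "S \<subseteq> ?gens")
    case True
    then show ?thesis
      using finite by (intro card_mono) auto
  next
    case False
    then obtain x where x: "x \<in> S" "x \<notin> ?gens" by blast
    have sub: "S \<subseteq> carrier ?Z"
      using S unfolding independent_set_def verts by blast
    \<comment> \<open>A non-generator is adjacent to every other vertex, so it can only be alone in
      an independent set.\<close>
    have "y = x" if "y \<in> S" for y
      using S x that sub adjacent_iff[of x y] unfolding independent_set_def by blast
    then have "S \<subseteq> {x}" by blast
    then have "card S \<le> 1"
      using card_mono[of "{x}" S] by simp
    \<comment> \<open>Both factors are positive, so a singleton does not exceed the claimed
      maximum.\<close>
    also have "1 \<le> (p - 1) * (q - 1)"
      using prime_gt_1_nat[OF assms(1)] prime_gt_1_nat[OF assms(2)] by (simp add: Suc_le_eq)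
    finally show ?thesis by (simp only: card_gens)
  qed
  \<comment> \<open>\<open>Max\<close> needs a finite set: by \<open>le\<close> all the
    cardinalities lie in \<open>{..card ?gens}\<close>, and \<open>gens\<close> shows that the bound
    is attained.\<close>
  have "Max {card S | S. independent_set ?\<Theta> S} = card ?gens"
    by (rule Max_eqI) (use le gens in \<open>auto intro: finite_subset[of _ "{..card ?gens}"]\<close>)
  then show ?thesis
    unfolding independence_number_def card_gens .
qed

end
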